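(* Consider the stump model $Y_i=f(i/N)+\varepsilon_i$, $i=1,\dots,N$, with $\varepsilon_i$ i.i.d. $N(0,\sigma^2)$ and $f(x)=\alpha 1(x\le\tau)+\beta 1(x>\tau)$, where $\alpha\neq\beta$ and $\tau\in(0,1)$ are constants, and put $\tau_N=\lfloor N\tau\rfloor/N$. Let $\hat\tau^{(2)}_N$ be the two-stage intelligent sampling estimator described in the context. Then, as $N\to\infty$, $$|\hat\tau^{(2)}_N-\tau_N|=O_p(1/N).$$
   Context: Two-stage intelligent sampling for a single change point. Fix constants $\gamma\in(0,1)$, $K_1,K_2>0$ and a small constant $\delta$ with $0<\delta<\gamma$; put $N_1=K_1N^\gamma$. Stage 1: let $S^{(1)}=\{i/N: i\in\mathbb N,\ i<N,\ i \text{ divisible by } \lfloor N/N_1\rfloor\}$. Using only the data $(i/N,Y_i)$ with $i/N\in S^{(1)}$, let $(\hat\alpha^{(1)},\hat\beta^{(1)},\hat\tau^{(1)}_N)$ be a minimizer over $(a,b,t)\in\mathbb R^2\times(0,1)$ of $\sum_{i/N\in S^{(1)}}\big(Y_i-a1(i/N\le t)-b1(i/N>t)\big)^2$, with $t$ taken in the grid $S^{(1)}$. Stage 2: let $S^{(2)}$ be the set of all $i/N$, $1\le i\le N$, with $i/N\in[\hat\tau^{(1)}_N-K_2N^{-\gamma+\delta},\hat\tau^{(1)}_N+K_2N^{-\gamma+\delta}]$ and $i/N\notin S^{(1)}$. The estimator $\hat\tau^{(2)}_N$ is the minimizer over $d\in S^{(2)}$ of $$\sum_{i/N\in S^{(2)}}\big(Y_i-\hat\alpha^{(1)}1(i/N\le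 d)-\hat\beta^{(1)}1(i/N>d)\big)^2 .$$ *)

theory Defs
  imports "HOL-Probability.Probability"
begin

definition stump :: "real \<Rightarrow> real \<Rightarrow> real \<Rightarrow> real \<Rightarrow> real" where
  "stump a b t x = a * of_bool (x \<le> t) + b * of_bool (x > t)"

(* A data vector is a function y of which only y 1, ..., y N are ever used. *)
definition rss :: "nat \<Rightarrow> real set \<Rightarrow> (nat \<Rightarrow> real) \<Rightarrow> real \<Rightarrow> real \<Rightarrow> real \<Rightarrow> real" where
  "rss N S y a b t =
     (\<Sum>i | i \<in> {1..N} \<and> real i / real N \<in> S. (y i - stump a b t (real i / real N))\<^sup>2)"

(* For small N the rounded spacing can be 0; no i > 0 is a multiple of 0, so the grid is
   then empty.  For all large N the grid is nonempty. *)
definition stage1_idx :: "real \<Rightarrow> real \<Rightarrow> nat \<Rightarrow> nat set" where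
  "stage1_idx K1 \<gamma> N =
     {i. 0 < i \<and> i < N \<and> nat \<lfloor>real N / (K1 * real N powr \<gamma>)\<rfloor> dvd i}"

definition stage1_grid :: "real \<Rightarrow> real \<Rightarrow> nat \<Rightarrow> real set" where
  "stage1_grid K1 \<gamma> N = (\<lambda>i. real i / real N) ` stage1_idx K1 \<gamma> N"

definition stage2_grid :: "real \<Rightarrow> real \<Rightarrow> real \<Rightarrow> real \<Rightarrow> nat \<Rightarrow> real \<Rightarrow> real set" where
  "stage2_grid K1 K2 \<gamma> \<delta> N t =
     {real i / real N | i. i \<in> {1..N}
        \<and> real i / real N \<in> {t - K2 * real N powr (-\<gamma> + \<delta>) .. t + K2 * real N powr (-\<gamma> + \<delta>)}
        \<and> real i / real N \<notin> stage1_grid K1 \<gamma> N}"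

(* The estimator is a Borel function of the first-stage data only.  Minimizers need not be
   unique: if t is the last grid point, then b is not determined.  Any measurable
   choice of minimizers is admitted.  Nothing is required when there is no point to choose. *)
definition stage1_estimator ::
    "real \<Rightarrow> real \<Rightarrow> (nat \<Rightarrow> (nat \<Rightarrow> real) \<Rightarrow> real \<times> real \<times> real) \<Rightarrow> bool" where
  "stage1_estimator K1 \<gamma> est1 \<longleftrightarrow>
     (\<forall>N. est1 N \<in> borel_measurable (PiM (stage1_idx K1 \<gamma> N) (\<lambda>_. borel)) \<and>
        (stage1_grid K1 \<gamma> N \<noteq> {} \<longrightarrow>
          (\<forall>y. is_arg_min
             (\<lambda>(a, b, t). rss N (stage1_grid K1 \<gamma> N) y a b t)
             (\<lambda>(a, b, t). t \<in> {0<..<1} \<and> t \<in> stage1_grid K1 \<gamma> N)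
             (est1 N (restrict y (stage1_idx K1 \<gamma> N))))))"

definition stage2_estimator ::
    "real \<Rightarrow> real \<Rightarrow> real \<Rightarrow> real \<Rightarrow> (nat \<Rightarrow> (nat \<Rightarrow> real) \<Rightarrow> real \<times> real \<times> real)
      \<Rightarrow> (nat \<Rightarrow> (nat \<Rightarrow> real) \<Rightarrow> real) \<Rightarrow> bool" where
  "stage2_estimator K1 K2 \<gamma> \<delta> est1 est2 \<longleftrightarrow>
     (\<forall>N. est2 N \<in> borel_measurable (PiM {1..N} (\<lambda>_. borel)) \<and>
        (\<forall>y. case est1 N (restrict y (stage1_idx K1 \<gamma> N)) of (a, b, t) \<Rightarrow>
           stage2_grid K1 K2 \<gamma> \<delta> N t \<noteq> {} \<longrightarrow>
           is_arg_min
             (rss N (stage2_grid K1 K2 \<gamma> \<delta> N t) y a b)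
             (\<lambda>d. d \<in> stage2_grid K1 K2 \<gamma> \<delta> N t)
             (est2 N (restrict y {1..N}))))"

(* Measurability is part of the definition because measure gives 0 on nonmeasurable sets. *)
definition big_O_p :: "'a measure \<Rightarrow> (nat \<Rightarrow> 'a \<Rightarrow> real) \<Rightarrow> (nat \<Rightarrow> real) \<Rightarrow> bool" where
  "big_O_p M X r \<longleftrightarrow>
     (\<forall>N. X N \<in> borel_measurable M) \<and>
     (\<forall>\<eta>>0. \<exists>C. \<forall>\<^sub>F N in sequentially.
        measure M {\<omega> \<in> space M. \<bar>X N \<omega>\<bar> > C * \<bar>r N\<bar>} < \<eta>)"

end

theory Submission imports Defs "HOL-Real_Asymp.Real_Asymp" begin

text \<open>
  Both stages are handled by deterministic arguments on events of high probability that involve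
  only the noise.  With \<open>L = N powr (\<delta> / 2)\<close>, Gaussian tails and a union bound show that every
  sum of \<open>n\<close> consecutive first-stage errors is at most \<open>sqrt (L n)\<close> in absolute value; the basic
  inequality of least squares then puts the first-stage levels near \<open>\<alpha>\<close>, \<open>\<beta>\<close> and the first-stage
  change point within \<open>O(L)\<close> grid cells of \<open>\<tau>\<close>, which is well inside the second-stage window.
  For such levels, choosing a change point \<open>n \<ge> C\<close> steps away from \<open>\<tau>\<close> in the second stage forces a
  sum of second-stage errors on one side of \<open>\<tau>\<close> to be at least \<open>|\<alpha> - \<beta>| / 4\<close> times its length.
  This event depends neither on the window nor on the first-stage fit, so no
  conditioning is needed, and its probability is bounded by a geometric tail that tends
  to 0 as \<open>C\<close> grows.
\<close>

subsection \<open>Sums of Gaussian errors\<close>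

context prob_space
begin

section \<open>Gaussian tails for one error and for sums of errors\<close>

text \<open>For \<open>x >= t >= 0\<close> one has \<open>x^2 >= t^2 + (x - t)^2\<close>. Hence on
  the tail the centred density is at most \<open>exp (- t^2 / (2 * s^2))\<close> times the density
  with mean \<open>t\<close>, and the latter has total mass 1.\<close>

lemma prob_normal_ge:
  assumes "distributed M lborel X (normal_density 0 s)" "0 < s" "0 \<le> t"
  shows "prob {\<omega> \<in> space M. t \<le> X \<omega>} \<le> exp (- t\<^sup>2 / (2 * s\<^sup>2))"
proof -
  have shift: "normal_density 0 s x * indicator {t..} x
      \<le> exp (- t\<^sup>2 / (2 * s\<^sup>2)) * normal_density t s x" for x
  proof (cases "t \<le> x")
    case ge: True
    have "t * t \<le> t * x" using assms(3) ge by (intro mult_left_mono) auto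
    hence "- x\<^sup>2 \<le> - t\<^sup>2 - (x - t)\<^sup>2"
      by (simp add: power2_eq_square algebra_simps)
    hence "- x\<^sup>2 / (2 * s\<^sup>2) \<le> (- t\<^sup>2 - (x - t)\<^sup>2) / (2 * s\<^sup>2)"
      by (intro divide_right_mono) auto
    hence "exp (- x\<^sup>2 / (2 * s\<^sup>2)) \<le> exp (- t\<^sup>2 / (2 * s\<^sup>2)) * exp (- (x - t)\<^sup>2 / (2 * s\<^sup>2))"
      unfolding exp_add[symmetric] by (simp add: diff_divide_distrib)
    thus ?thesis using ge \<open>0 < s\<close>
      by (simp add: normal_density_def divide_right_mono)
  qed (simp add: normal_density_nonneg)
  have "emeasure M {\<omega> \<in> space M. t \<le> X \<omega>} = emeasure M (X -` {t..} \<inter> space M)"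
    by (intro arg_cong[where f = "emeasure M"]) auto
  also have "\<dots> = (\<integral>\<^sup>+x. ennreal (normal_density 0 s x) * indicator {t..} x \<partial>lborel)"
    by (rule distributed_emeasure[OF assms(1)]) simp
  also have "\<dots> \<le> (\<integral>\<^sup>+x. ennreal (exp (- t\<^sup>2 / (2 * s\<^sup>2))) * ennreal (normal_density t s x) \<partial>lborel)"
  proof (intro nn_integral_mono)
    fix x
    have "ennreal (normal_density 0 s x) * indicator {t..} x
        = ennreal (normal_density 0 s x * indicator {t..} x)"
      by (simp split: split_indicator)
    also have "\<dots> \<le> ennreal (exp (- t\<^sup>2 / (2 * s\<^sup>2)) * normal_density t s x)"
      by (intro ennreal_leI shift)
    finally show "ennreal (normal_density 0 s x) * indicator {t..} x
        \<le> ennreal (exp (- t\<^sup>2 / (2 * s\<^sup>2))) * ennreal (normal_density t s x)"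
      by (simp add: ennreal_mult normal_density_nonneg)
  qed
  also have "\<dots> = ennreal (exp (- t\<^sup>2 / (2 * s\<^sup>2)))"
    using \<open>0 < s\<close>
    by (subst nn_integral_cmult) (auto simp: nn_integral_eq_integral normal_density_nonneg)
  finally show ?thesis by (simp add: emeasure_eq_measure)
qed

lemma prob_abs_normal_ge:
  assumes X: "distributed M lborel X (normal_density 0 s)" and "0 < s" "0 \<le> t"
  shows "prob {\<omega> \<in> space M. t \<le> \<bar>X \<omega>\<bar>} \<le> 2 * exp (- t\<^sup>2 / (2 * s\<^sup>2))"
proof -
  have [measurable]: "random_variable borel X"
    using distributed_measurable[OF X] by simp
  have minus: "distributed M lborel (\<lambda>\<omega>. - X \<omega>) (normal_density 0 s)"
    using normal_density_affine[OF X \<open>0 < s\<close>, of "-1" 0] by simp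
  have "prob {\<omega> \<in> space M. t \<le> \<bar>X \<omega>\<bar>}
      \<le> prob ({\<omega> \<in> space M. t \<le> X \<omega>} \<union> {\<omega> \<in> space M. t \<le> - X \<omega>})"
    by (intro finite_measure_mono) auto
  also have "\<dots> \<le> prob {\<omega> \<in> space M. t \<le> X \<omega>} + prob {\<omega> \<in> space M. t \<le> - X \<omega>}"
    by (intro measure_Un_le) measurable
  also have "\<dots> \<le> 2 * exp (- t\<^sup>2 / (2 * s\<^sup>2))"
    using prob_normal_ge[OF X assms(2,3)] prob_normal_ge[OF minus assms(2,3)] by simp
  finally show ?thesis .
qed

lemma prob_abs_sum_indep_normal_ge:
  assumes "indep_vars (\<lambda>_. borel) X J" "I \<subseteq> J" "finite I" "I \<noteq> {}"
    and "\<And>i. i \<in> J \<Longrightarrow> distributed M lborel (X i) (normal_density 0 \<sigma>)"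
    and "0 < \<sigma>" "0 \<le> t"
  shows "prob {\<omega> \<in> space M. t \<le> \<bar>\<Sum>i\<in>I. X i \<omega>\<bar>} \<le> 2 * exp (- t\<^sup>2 / (2 * \<sigma>\<^sup>2 * card I))"
proof -
  have card: "0 < real (card I)" using assms(3,4) by (simp add: card_gt_0_iff)
  have "distributed M lborel (\<lambda>\<omega>. \<Sum>i\<in>I. X i \<omega>)
      (normal_density (\<Sum>i\<in>I. 0) (sqrt (\<Sum>i\<in>I. \<sigma>\<^sup>2)))"
    using assms indep_vars_subset[OF assms(1,2)] by (intro sum_indep_normal) auto
  hence "distributed M lborel (\<lambda>\<omega>. \<Sum>i\<in>I. X i \<omega>) (normal_density 0 (sqrt (card I * \<sigma>\<^sup>2)))"
    by simp
  from prob_abs_normal_ge[OF this _ \<open>0 \<le> t\<close>] show ?thesis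
    using card \<open>0 < \<sigma>\<close> by (simp add: mult_ac)
qed

section \<open>Union bounds over families of index sets\<close>

text \<open>The threshold \<open>t\<close> may depend on the index set. The two lemmas that follow
  choose it of order \<open>sqrt (card A)\<close> for the first stage and linear in
  \<open>card A\<close> for the second.\<close>

lemma prob_exists_large_sum_le:
  assumes "indep_vars (\<lambda>_. borel) X J" "finite \<A>"
    and "\<And>A. A \<in> \<A> \<Longrightarrow> A \<subseteq> J \<and> finite A \<and> A \<noteq> {}"
    and "\<And>i. i \<in> J \<Longrightarrow> distributed M lborel (X i) (normal_density 0 \<sigma>)"
    and "0 < \<sigma>" "\<And>A. A \<in> \<A> \<Longrightarrow> 0 \<le> t A"
  shows "{\<omega> \<in> space M. \<exists>A\<in>\<A>. t A \<le> \<bar>\<Sum>i\<in>A. X i \<omega>\<bar>} \<in> events"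
    and "prob {\<omega> \<in> space M. \<exists>A\<in>\<A>. t A \<le> \<bar>\<Sum>i\<in>A. X i \<omega>\<bar>}
        \<le> (\<Sum>A\<in>\<A>. 2 * exp (- (t A)\<^sup>2 / (2 * \<sigma>\<^sup>2 * card A)))"
proof -
  have eq: "{\<omega> \<in> space M. \<exists>A\<in>\<A>. t A \<le> \<bar>\<Sum>i\<in>A. X i \<omega>\<bar>}
      = (\<Union>A\<in>\<A>. {\<omega> \<in> space M. t A \<le> \<bar>\<Sum>i\<in>A. X i \<omega>\<bar>})" by auto
  have ev: "{\<omega> \<in> space M. t A \<le> \<bar>\<Sum>i\<in>A. X i \<omega>\<bar>} \<in> events" if "A \<in> \<A>" for A
  proof -
    have [measurable]: "random_variable borel (X i)" if "i \<in> A" for i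
    proof -
      have "i \<in> J" using assms(3)[OF \<open>A \<in> \<A>\<close>] that by blast
      from distributed_measurable[OF assms(4)[OF this]] show ?thesis by simp
    qed
    show ?thesis by measurable
  qed
  show "{\<omega> \<in> space M. \<exists>A\<in>\<A>. t A \<le> \<bar>\<Sum>i\<in>A. X i \<omega>\<bar>} \<in> events"
    unfolding eq using assms(2) ev by (rule sets.finite_UN)
  have "prob (\<Union>A\<in>\<A>. {\<omega> \<in> space M. t A \<le> \<bar>\<Sum>i\<in>A. X i \<omega>\<bar>})
      \<le> (\<Sum>A\<in>\<A>. prob {\<omega> \<in> space M. t A \<le> \<bar>\<Sum>i\<in>A. X i \<omega>\<bar>})"
    using assms(2) ev by (intro measure_UNION_le)
  also have "\<dots> \<le> (\<Sum>A\<in>\<A>. 2 * exp (- (t A)\<^sup>2 / (2 * \<sigma>\<^sup>2 * card A)))"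
    using assms by (intro sum_mono prob_abs_sum_indep_normal_ge[where J = J]) auto
  finally show "prob {\<omega> \<in> space M. \<exists>A\<in>\<A>. t A \<le> \<bar>\<Sum>i\<in>A. X i \<omega>\<bar>}
        \<le> (\<Sum>A\<in>\<A>. 2 * exp (- (t A)\<^sup>2 / (2 * \<sigma>\<^sup>2 * card A)))" unfolding eq .
qed

text \<open>With the threshold \<open>sqrt (L * card A)\<close> the cardinality cancels in the
  Gaussian exponent, so all sets share one bound, and two endpoints in \<open>{..N}\<close> give at
  most \<open>(N + 1)^2\<close> sets. The empty set is removed because its threshold is 0 and would
  always be reached.\<close>

lemma prob_exists_interval_sum_ge:
  fixes L :: real
  assumes "indep_vars (\<lambda>_. borel) X {1..N}" "S \<subseteq> {1..N}"
    and "\<And>i. i \<in> {1..N} \<Longrightarrow> distributed M lborel (X i) (normal_density 0 \<sigma>)"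
    and "0 < \<sigma>" "0 \<le> L"
  defines "\<A> \<equiv> (\<lambda>(u, v). S \<inter> {u<..v}) ` ({..N} \<times> {..N}) - {{}}"
  shows "{\<omega> \<in> space M. \<exists>A\<in>\<A>. sqrt (L * card A) \<le> \<bar>\<Sum>i\<in>A. X i \<omega>\<bar>} \<in> events"
    and "prob {\<omega> \<in> space M. \<exists>A\<in>\<A>. sqrt (L * card A) \<le> \<bar>\<Sum>i\<in>A. X i \<omega>\<bar>}
        \<le> 2 * (real N + 1)\<^sup>2 * exp (- L / (2 * \<sigma>\<^sup>2))"
proof -
  have fin: "finite \<A>" unfolding \<A>_def by simp
  have sub: "A \<subseteq> {1..N} \<and> finite A \<and> A \<noteq> {}" if "A \<in> \<A>" for A
    using that assms(2) unfolding \<A>_def by (auto intro: finite_subset[of _ "{1..N}"])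
  have cardA: "0 < card A" if "A \<in> \<A>" for A
    using sub[OF that] by (simp add: card_gt_0_iff)
  note * = prob_exists_large_sum_le[OF assms(1) fin sub assms(3,4), where t = "\<lambda>A. sqrt (L * card A)"]
  show "{\<omega> \<in> space M. \<exists>A\<in>\<A>. sqrt (L * card A) \<le> \<bar>\<Sum>i\<in>A. X i \<omega>\<bar>} \<in> events"
    using \<open>0 \<le> L\<close> by (intro *(1)) auto
  have "prob {\<omega> \<in> space M. \<exists>A\<in>\<A>. sqrt (L * card A) \<le> \<bar>\<Sum>i\<in>A. X i \<omega>\<bar>}
      \<le> (\<Sum>A\<in>\<A>. 2 * exp (- (sqrt (L * card A))\<^sup>2 / (2 * \<sigma>\<^sup>2 * card A)))"
    using \<open>0 \<le> L\<close> by (intro *(2)) auto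
  also have "\<dots> = (\<Sum>A\<in>\<A>. 2 * exp (- L / (2 * \<sigma>\<^sup>2)))"
    using cardA \<open>0 \<le> L\<close> by (intro sum.cong refl) (auto simp: field_simps)
  also have "\<dots> = card \<A> * (2 * exp (- L / (2 * \<sigma>\<^sup>2)))" by simp
  also have "\<dots> \<le> (real N + 1)\<^sup>2 * (2 * exp (- L / (2 * \<sigma>\<^sup>2)))"
  proof (rule mult_right_mono)
    have "card \<A> \<le> card ((\<lambda>(u, v). S \<inter> {u<..v}) ` ({..N} \<times> {..N}))"
      unfolding \<A>_def by (intro card_mono) auto
    also have "\<dots> \<le> card ({..N} \<times> {..N})" by (intro card_image_le) auto
    also have "\<dots> = (N + 1)\<^sup>2" by (simp add: power2_eq_square)
    finally have "real (card \<A>) \<le> real ((N + 1)\<^sup>2)" by linarith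
    thus "real (card \<A>) \<le> (real N + 1)\<^sup>2" by (simp add: add.commute)
  qed simp
  finally show "prob {\<omega> \<in> space M. \<exists>A\<in>\<A>. sqrt (L * card A) \<le> \<bar>\<Sum>i\<in>A. X i \<omega>\<bar>}
        \<le> 2 * (real N + 1)\<^sup>2 * exp (- L / (2 * \<sigma>\<^sup>2))" by simp
qed

text \<open>A linear threshold makes the exponent proportional to \<open>card (F n)\<close>, which
  is at least \<open>(n - 1) / 2\<close>. The union bound is then dominated by a geometric series in
  \<open>n\<close> started at \<open>C\<close>, so the bound is free of \<open>N\<close> even though
  the number of sets may grow with \<open>N\<close>.\<close>

lemma prob_exists_linear_sum_ge:
  fixes F :: "nat \<Rightarrow> nat set" and C :: nat
  assumes "indep_vars (\<lambda>_. borel) X {1..N}"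
    and F: "\<And>n. n \<in> R \<Longrightarrow> F n \<subseteq> {1..N} \<and> C \<le> n \<and> n \<le> 2 * card (F n) + 1"
    and "finite R" "2 \<le> C"
    and "\<And>i. i \<in> {1..N} \<Longrightarrow> distributed M lborel (X i) (normal_density 0 \<sigma>)"
    and "0 < \<sigma>" "0 < c"
  defines "q \<equiv> exp (- c\<^sup>2 / (4 * \<sigma>\<^sup>2))"
  shows "{\<omega> \<in> space M. \<exists>A\<in>F ` R. c * card A \<le> \<bar>\<Sum>i\<in>A. X i \<omega>\<bar>} \<in> events"
    and "prob {\<omega> \<in> space M. \<exists>A\<in>F ` R. c * card A \<le> \<bar>\<Sum>i\<in>A. X i \<omega>\<bar>}
        \<le> 2 * q ^ (C - 1) / (1 - q)"
proof -
  have fin: "finite (F ` R)" using assms(3) by simp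
  \<comment> \<open>With \<open>n = 1\<close> the set could be empty; \<open>2 \<le> C\<close>
    excludes this.\<close>
  have cardF: "0 < card (F n)" if "n \<in> R" for n using F[OF that] \<open>2 \<le> C\<close> by linarith
  have sub: "A \<subseteq> {1..N} \<and> finite A \<and> A \<noteq> {}" if "A \<in> F ` R" for A
  proof -
    from that obtain n where "n \<in> R" "A = F n" by blast
    thus ?thesis using F[of n] cardF[of n] by (metis card_gt_0_iff)
  qed
  have q: "0 < q" "q < 1" unfolding q_def using \<open>0 < c\<close> \<open>0 < \<sigma>\<close> by auto
  note * = prob_exists_large_sum_le[OF assms(1) fin sub assms(5,6), where t = "\<lambda>A. c * card A"]
  show "{\<omega> \<in> space M. \<exists>A\<in>F ` R. c * card A \<le> \<bar>\<Sum>i\<in>A. X i \<omega>\<bar>} \<in> events"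
    using \<open>0 < c\<close> by (intro *(1)) auto
  have "prob {\<omega> \<in> space M. \<exists>A\<in>F ` R. c * card A \<le> \<bar>\<Sum>i\<in>A. X i \<omega>\<bar>}
      \<le> (\<Sum>A\<in>F ` R. 2 * exp (- (c * card A)\<^sup>2 / (2 * \<sigma>\<^sup>2 * card A)))"
    using \<open>0 < c\<close> by (intro *(2)) auto
  \<comment> \<open>\<open>F\<close> is not assumed injective, so passing from sets to their indices
    gives only an inequality.\<close>
  also have "\<dots> \<le> (\<Sum>n\<in>R. 2 * exp (- (c * card (F n))\<^sup>2 / (2 * \<sigma>\<^sup>2 * card (F n))))"
    using sum_image_le[OF assms(3), of "\<lambda>A. 2 * exp (- (c * card A)\<^sup>2 / (2 * \<sigma>\<^sup>2 * card A))" F]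
    by simp
  also have "\<dots> \<le> (\<Sum>n\<in>R. 2 * q ^ (n - 1))"
  proof (rule sum_mono)
    fix n assume n: "n \<in> R"
    have "real (n - 1) \<le> 2 * card (F n)" using F[OF n] by linarith
    hence "c\<^sup>2 * real (n - 1) / (4 * \<sigma>\<^sup>2) \<le> c\<^sup>2 * (2 * card (F n)) / (4 * \<sigma>\<^sup>2)"
      by (intro divide_right_mono mult_left_mono) auto
    also have "\<dots> = (c * card (F n))\<^sup>2 / (2 * \<sigma>\<^sup>2 * card (F n))"
      using cardF[OF n] by (simp add: power2_eq_square field_simps)
    finally have "exp (- (c * card (F n))\<^sup>2 / (2 * \<sigma>\<^sup>2 * card (F n)))
        \<le> exp (real (n - 1) * (- c\<^sup>2 / (4 * \<sigma>\<^sup>2)))"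
      by (simp add: mult.commute)
    thus "2 * exp (- (c * card (F n))\<^sup>2 / (2 * \<sigma>\<^sup>2 * card (F n))) \<le> 2 * q ^ (n - 1)"
      unfolding q_def exp_of_nat_mult by simp
  qed
  \<comment> \<open>All \<open>n\<close> in \<open>R\<close> are at least \<open>C\<close>, so the
    truncated subtraction \<open>n - C\<close> is injective there and the factor
    \<open>q ^ (C - 1)\<close> comes out of each term.\<close>
  also have "\<dots> = (\<Sum>m\<in>(\<lambda>n. n - C) ` R. 2 * q ^ (C - 1) * q ^ m)"
  proof (subst sum.reindex)
    show "inj_on (\<lambda>n. n - C) R" using F by (intro inj_onI) (metis eq_diff_iff)
    have "q ^ (n - 1) = q ^ (C - 1) * q ^ (n - C)" if "n \<in> R" for n
      using F[OF that] \<open>2 \<le> C\<close> by (simp flip: power_add)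
    thus "(\<Sum>n\<in>R. 2 * q ^ (n - 1)) = sum ((\<lambda>m. 2 * q ^ (C - 1) * q ^ m) \<circ> (\<lambda>n. n - C)) R"
      by (intro sum.cong) auto
  qed
  also have "\<dots> = 2 * q ^ (C - 1) * (\<Sum>m\<in>(\<lambda>n. n - C) ` R. q ^ m)"
    by (simp add: sum_distrib_left)
  also have "\<dots> \<le> 2 * q ^ (C - 1) * (\<Sum>m. q ^ m)"
    using q assms(3) by (intro mult_left_mono sum_le_suminf summable_geometric) auto
  also have "\<dots> = 2 * q ^ (C - 1) / (1 - q)" using q by (simp add: suminf_geometric)
  finally show "prob {\<omega> \<in> space M. \<exists>A\<in>F ` R. c * card A \<le> \<bar>\<Sum>i\<in>A. X i \<omega>\<bar>}
        \<le> 2 * q ^ (C - 1) / (1 - q)" .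
qed

end

subsection \<open>First stage\<close>

lemma card_multiples:
  fixes s u v :: nat
  assumes "0 < s"
  shows "card {i. u < i \<and> i \<le> v \<and> s dvd i} = v div s - u div s"
proof -
  have "{i. u < i \<and> i \<le> v \<and> s dvd i} = (\<lambda>k. s * k) ` {u div s<..v div s}"
  proof (intro equalityI subsetI)
    fix i assume "i \<in> {i. u < i \<and> i \<le> v \<and> s dvd i}"
    then obtain k where "i = s * k" "u < k * s" "k * s \<le> v" by (metis (lifting) dvdE mem_Collect_eq mult.commute)
    thus "i \<in> (\<lambda>k. s * k) ` {u div s<..v div s}"
      using assms by (auto simp: div_less_iff_less_mult less_eq_div_iff_mult_less_eq)
  next
    fix i assume "i \<in> (\<lambda>k. s * k) ` {u div s<..v div s}"
    thus "i \<in> {i. u < i \<and> i \<le> v \<and> s dvd i}"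
      using assms by (auto simp: div_less_iff_less_mult less_eq_div_iff_mult_less_eq mult.commute)
  qed
  moreover have "inj_on (\<lambda>k. s * k) {u div s<..v div s}" using assms by (auto intro: inj_onI)
  ultimately show ?thesis by (simp add: card_image)
qed

text \<open>For \<open>s >= 2\<close> the successor of a multiple is not a multiple, so the
  multiples other than \<open>v\<close> inject into the non-multiples. The successor of
  \<open>v\<close> falls outside the interval, which costs the \<open>+ 1\<close>. Thus removing the
  first-stage points leaves about half of any interval or more.\<close>

lemma card_nonmultiples_ge:
  fixes s u v :: nat
  assumes "2 \<le> s"
  shows "v - u \<le> 2 * card {i. u < i \<and> i \<le> v \<and> \<not> s dvd i} + 1"
proof -
  let ?D = "{i. u < i \<and> i \<le> v \<and> s dvd i}" and ?E = "{i. u < i \<and> i \<le> v \<and> \<not> s dvd i}"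
  have fin: "finite ?D" "finite ?E" by (auto intro: finite_subset[of _ "{..v}"])
  have "Suc ` (?D - {v}) \<subseteq> ?E"
  proof
    fix x assume "x \<in> Suc ` (?D - {v})"
    then obtain i where i: "x = Suc i" "u < i" "i < v" "s dvd i" by force
    have "\<not> s dvd Suc i" using \<open>s dvd i\<close> assms dvd_diff_nat[of s "Suc i" i] by auto
    thus "x \<in> ?E" using i by auto
  qed
  hence "card (Suc ` (?D - {v})) \<le> card ?E" using fin by (intro card_mono)
  hence "card (?D - {v}) \<le> card ?E" by (simp add: card_image)
  moreover have "card ?D \<le> card (?D - {v}) + 1"
    using diff_card_le_card_Diff[of "{v}" ?D] by simp
  moreover have "v - u = card ?D + card ?E"
  proof -
    have "card ({u<..v}) = card (?D \<union> ?E)" by (intro arg_cong[where f = card]) auto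
    thus ?thesis using fin by (subst (asm) card_Un_disjoint) auto
  qed
  ultimately show ?thesis by linarith
qed

section \<open>Deterministic analysis of the first-stage least-squares fit\<close>

text \<open>Here \<open>f\<close> is the true signal, \<open>e\<close> the error and
  \<open>h\<close> the fit. Expanding the squares cancels the terms in \<open>e\<close> alone and
  leaves the cross term as the only upper bound on the fitting error.\<close>

lemma least_squares_basic_inequality:
  fixes f h e :: "'i \<Rightarrow> real"
  assumes "(\<Sum>i\<in>I. (f i + e i - h i)\<^sup>2) \<le> (\<Sum>i\<in>I. (f i + e i - f i)\<^sup>2)"
  shows "(\<Sum>i\<in>I. (h i - f i)\<^sup>2) \<le> 2 * (\<Sum>i\<in>I. e i * (h i - f i))"
proof -
  have "(\<Sum>i\<in>I. (f i + e i - h i)\<^sup>2) = (\<Sum>i\<in>I. (f i + e i - f i)\<^sup>2 + (h i - f i)\<^sup>2 - 2 * (e i * (h i - f i)))"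
    by (intro sum.cong) (auto simp: power2_eq_square algebra_simps)
  thus ?thesis using assms by (simp add: sum.distrib sum_subtractf sum_distrib_left)
qed

text \<open>The fitting error is constant on each class of \<open>\<kappa>\<close>, so the cross
  term only involves the error sums of the classes. These are of size \<open>sqrt (L * n)\<close>,
  and half of the squared fitting error absorbs them at a cost of \<open>2 * L\<close> per
  class.\<close>

lemma piecewise_constant_least_squares:
  fixes g :: "'k \<Rightarrow> real" and \<kappa> :: "'i \<Rightarrow> 'k" and L :: real
  assumes "finite I" "finite T" "\<kappa> ` I \<subseteq> T" "0 \<le> L"
    and basic: "(\<Sum>i\<in>I. (g (\<kappa> i))\<^sup>2) \<le> 2 * (\<Sum>i\<in>I. e i * g (\<kappa> i))"
    and noise: "\<And>x. x \<in> T \<Longrightarrow>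
      \<bar>\<Sum>i | i \<in> I \<and> \<kappa> i = x. e i\<bar> \<le> sqrt (L * card {i \<in> I. \<kappa> i = x})"
    and "x \<in> T"
  shows "card {i \<in> I. \<kappa> i = x} * (g x)\<^sup>2 \<le> 4 * card T * L"
proof -
  let ?n = "\<lambda>x. real (card {i \<in> I. \<kappa> i = x})" and ?E = "\<lambda>x. \<Sum>i | i \<in> I \<and> \<kappa> i = x. e i"
  have "(\<Sum>x\<in>T. ?n x * (g x)\<^sup>2) = (\<Sum>x\<in>T. \<Sum>i | i \<in> I \<and> \<kappa> i = x. (g (\<kappa> i))\<^sup>2)"
    by (intro sum.cong refl) simp
  also have "\<dots> = (\<Sum>i\<in>I. (g (\<kappa> i))\<^sup>2)" using assms(1-3) by (rule sum.group)
  also have "\<dots> \<le> 2 * (\<Sum>i\<in>I. e i * g (\<kappa> i))" by (rule basic)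
  also have "(\<Sum>i\<in>I. e i * g (\<kappa> i)) = (\<Sum>x\<in>T. \<Sum>i | i \<in> I \<and> \<kappa> i = x. e i * g (\<kappa> i))"
    using assms(1-3) by (rule sum.group[symmetric])
  also have "\<dots> = (\<Sum>x\<in>T. ?E x * g x)"
    by (intro sum.cong refl) (simp add: sum_distrib_right)
  also have "2 * \<dots> \<le> (\<Sum>x\<in>T. ?n x * (g x)\<^sup>2 / 2 + 2 * L)"
    unfolding sum_distrib_left
  proof (rule sum_mono)
    fix x assume "x \<in> T"
    have "?E x * g x \<le> \<bar>?E x\<bar> * \<bar>g x\<bar>" by (metis abs_ge_self abs_mult)
    also have "\<dots> \<le> sqrt (L * ?n x) * \<bar>g x\<bar>" using noise[OF \<open>x \<in> T\<close>] by (rule mult_right_mono) simp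
    also have "\<dots> = sqrt L * (sqrt (?n x) * \<bar>g x\<bar>)" by (simp add: real_sqrt_mult)
    finally have 1: "?E x * g x \<le> sqrt L * (sqrt (?n x) * \<bar>g x\<bar>)" .
    \<comment> \<open>Young's inequality, weighted so that exactly half of
      \<open>?n x * (g x)^2\<close> is spent.\<close>
    have "0 \<le> (2 * sqrt L - sqrt (?n x) * \<bar>g x\<bar>)\<^sup>2" by simp
    also have "\<dots> = 4 * L + ?n x * (g x)\<^sup>2 - 4 * (sqrt L * (sqrt (?n x) * \<bar>g x\<bar>))"
      using \<open>0 \<le> L\<close> by (simp add: power2_diff power_mult_distrib)
    finally show "2 * (?E x * g x) \<le> ?n x * (g x)\<^sup>2 / 2 + 2 * L" using 1 by linarith
  qed
  also have "\<dots> = (\<Sum>x\<in>T. ?n x * (g x)\<^sup>2) / 2 + card T * (2 * L)"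
    by (simp add: sum.distrib sum_divide_distrib)
  finally have "(\<Sum>x\<in>T. ?n x * (g x)\<^sup>2) \<le> 4 * card T * L" by simp
  moreover have "?n x * (g x)\<^sup>2 \<le> (\<Sum>x\<in>T. ?n x * (g x)\<^sup>2)"
    using assms(2,7) by (intro member_le_sum) auto
  ultimately show ?thesis by linarith
qed

text \<open>\<open>x\<close> is a level fitted to \<open>n\<close> points of true level
  \<open>\<alpha>\<close> and \<open>p\<close> points of true level \<open>\<beta>\<close>, and
  \<open>z\<close> is fitted to \<open>r\<close> further points of true level
  \<open>\<beta>\<close>. Many points at \<open>\<alpha>\<close> pin \<open>x\<close> near
  \<open>\<alpha>\<close>, hence away from \<open>\<beta>\<close>, so \<open>p\<close> must be small
  and the remaining points pin \<open>z\<close> near \<open>\<beta>\<close>. The constant is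
  \<open>1088 = 1024 + 64\<close>: 64 pays for the \<open>p\<close> misfitted points and 1024 is
  what closeness requires.\<close>

lemma level_separation:
  fixes x z \<alpha> \<beta> n p r L m :: real
  assumes "n * (x - \<alpha>)\<^sup>2 \<le> 16 * L" "p * (x - \<beta>)\<^sup>2 \<le> 16 * L" "r * (z - \<beta>)\<^sup>2 \<le> 16 * L"
    and "0 \<le> p" "m \<le> n" "m \<le> p + r" "0 < L" "\<alpha> \<noteq> \<beta>"
    and m: "1088 * L \<le> m * (\<alpha> - \<beta>)\<^sup>2"
  shows "\<bar>x - \<alpha>\<bar> \<le> \<bar>\<alpha> - \<beta>\<bar> / 8" "\<bar>z - \<beta>\<bar> \<le> \<bar>\<alpha> - \<beta>\<bar> / 8" "p \<le> 64 * L / (\<alpha> - \<beta>)\<^sup>2"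
proof -
  let ?D = "\<bar>\<alpha> - \<beta>\<bar>"
  have D: "0 < ?D" "?D\<^sup>2 = (\<alpha> - \<beta>)\<^sup>2" using \<open>\<alpha> \<noteq> \<beta>\<close> by auto
  note m = m[folded D(2)]
  \<comment> \<open>\<open>1024 = 16 * 8^2\<close>, with 16 from the class bounds and 8 from the
    target distance.\<close>
  have close: "\<bar>w - \<theta>\<bar> \<le> ?D / 8"
    if "k * (w - \<theta>)\<^sup>2 \<le> 16 * L" "1024 * L \<le> k * ?D\<^sup>2" for k w \<theta>
  proof (rule ccontr)
    assume "\<not> ?thesis"
    hence "(?D / 8)\<^sup>2 < \<bar>w - \<theta>\<bar>\<^sup>2" using D by (intro power_strict_mono) auto
    moreover have "0 < k"
    proof (rule ccontr)
      assume "\<not> 0 < k"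
      hence "k * ?D\<^sup>2 \<le> 0" by (simp add: mult_nonpos_nonneg)
      thus False using that(2) \<open>0 < L\<close> by linarith
    qed
    ultimately have "k * (?D / 8)\<^sup>2 < k * (w - \<theta>)\<^sup>2" by simp
    thus False using that by (simp add: power_divide)
  qed
  have "m * ?D\<^sup>2 \<le> n * ?D\<^sup>2" using \<open>m \<le> n\<close> by (intro mult_right_mono) auto
  hence "1024 * L \<le> n * ?D\<^sup>2" using m D \<open>0 < L\<close> by linarith
  from close[OF assms(1) this] show x: "\<bar>x - \<alpha>\<bar> \<le> ?D / 8" .
  have "?D \<le> \<bar>x - \<beta>\<bar> + \<bar>x - \<alpha>\<bar>" using abs_triangle_ineq4[of "x - \<beta>" "x - \<alpha>"] by simp
  hence "?D / 2 \<le> \<bar>x - \<beta>\<bar>" using x D(1) by argo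
  hence "(?D / 2)\<^sup>2 \<le> \<bar>x - \<beta>\<bar>\<^sup>2" by (intro power_mono) auto
  hence "p * (?D / 2)\<^sup>2 \<le> p * (x - \<beta>)\<^sup>2" using \<open>0 \<le> p\<close> by (intro mult_left_mono) auto
  hence p: "p * ?D\<^sup>2 \<le> 64 * L" using assms(2) by (simp add: power_divide)
  thus "p \<le> 64 * L / (\<alpha> - \<beta>)\<^sup>2" using D by (simp add: pos_le_divide_eq)
  have "m * ?D\<^sup>2 \<le> (p + r) * ?D\<^sup>2" using \<open>m \<le> p + r\<close> by (intro mult_right_mono) auto
  hence "1024 * L \<le> r * ?D\<^sup>2" using m D p by (simp add: distrib_right)
  from close[OF assms(3) this] show "\<bar>z - \<beta>\<bar> \<le> ?D / 8" .
qed

text \<open>The true index \<open>k\<close> and the fitted index \<open>j\<close> cut the grid into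
  four classes, at most one of which is misclassified with points in it. That class counts the grid
  points between \<open>j\<close> and \<open>k\<close>, so its bound from
  \<open>level_separation\<close>, times the spacing \<open>s\<close>, bounds the distance.\<close>

lemma coarse_fit_close:
  fixes N s k j :: nat and e y :: "nat \<Rightarrow> real" and a b \<alpha> \<beta> L :: real
  defines "I \<equiv> {i. 0 < i \<and> i < N \<and> s dvd i}"
  assumes "0 < s" "k < N" "j \<in> I" "\<alpha> \<noteq> \<beta>" "0 < L"
    and y: "\<And>i. i \<in> I \<Longrightarrow> y i = (if i \<le> k then \<alpha> else \<beta>) + e i"
    and min: "\<And>a' b' j'. j' \<in> I \<Longrightarrow>
      (\<Sum>i\<in>I. (y i - (if i \<le> j then a else b))\<^sup>2) \<le> (\<Sum>i\<in>I. (y i - (if i \<le> j' then a' else b'))\<^sup>2)"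
    and noise: "\<And>u v. u \<le> N \<Longrightarrow> v \<le> N \<Longrightarrow>
      \<bar>\<Sum>i\<in>I \<inter> {u<..v}. e i\<bar> \<le> sqrt (L * card (I \<inter> {u<..v}))"
    and left: "1088 * L \<le> real (k div s) * (\<alpha> - \<beta>)\<^sup>2"
    and right: "1088 * L \<le> (real ((N - 1) div s) - real (k div s)) * (\<alpha> - \<beta>)\<^sup>2"
  shows "\<bar>a - \<alpha>\<bar> \<le> \<bar>\<alpha> - \<beta>\<bar> / 8" "\<bar>b - \<beta>\<bar> \<le> \<bar>\<alpha> - \<beta>\<bar> / 8"
    "\<bar>real j - real k\<bar> \<le> s * (64 * L / (\<alpha> - \<beta>)\<^sup>2 + 1)"
proof -
  have finI: "finite I" unfolding I_def by (auto intro: finite_subset[of _ "{..N}"])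
  have jN: "j < N" "s dvd j" using \<open>j \<in> I\<close> by (auto simp: I_def)
  define f where "f i = (if i \<le> k then \<alpha> else \<beta>)" for i
  define h where "h i = (if i \<le> j then a else b)" for i
  \<comment> \<open>The class of \<open>i\<close> records its true side and its fitted side;
    \<open>g\<close> is then the fitted level minus the true one on that class.\<close>
  define \<kappa> where "\<kappa> i = (i \<le> k, i \<le> j)" for i
  define g where "g = (\<lambda>(p, q). (if q then a else b) - (if p then \<alpha> else \<beta>))"
  define n where "n x = real (card {i \<in> I. \<kappa> i = x})" for x
  have "0 < k div s" using left \<open>0 < L\<close> by (intro gr0I) auto
  define k' where "k' = s * (k div s)"
  \<comment> \<open>The true change point need not be on the grid, but splitting at \<open>k'\<close> is the same on \<open>I\<close>.\<close>
  have k': "k' \<in> I" using \<open>0 < k div s\<close> \<open>k < N\<close> \<open>0 < s\<close>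
    by (auto simp: I_def k'_def intro: le_less_trans[OF times_div_less_eq_dividend])
  have k'_iff: "i \<le> k' \<longleftrightarrow> i \<le> k" if i: "i \<in> I" for i
  proof
    assume "i \<le> k"
    thus "i \<le> k'" using i unfolding I_def k'_def
      by (auto elim!: dvdE simp: \<open>0 < s\<close> less_eq_div_iff_mult_less_eq mult.commute)
  next
    assume "i \<le> k'" thus "i \<le> k" unfolding k'_def using times_div_less_eq_dividend order_trans by blast
  qed
  have basic: "(\<Sum>i\<in>I. (g (\<kappa> i))\<^sup>2) \<le> 2 * (\<Sum>i\<in>I. e i * g (\<kappa> i))"
  proof -
    have "(\<Sum>i\<in>I. (f i + e i - h i)\<^sup>2) = (\<Sum>i\<in>I. (y i - (if i \<le> j then a else b))\<^sup>2)"
      by (intro sum.cong) (auto simp: y f_def h_def)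
    also have "\<dots> \<le> (\<Sum>i\<in>I. (y i - (if i \<le> k' then \<alpha> else \<beta>))\<^sup>2)" by (rule min[OF k'])
    also have "\<dots> = (\<Sum>i\<in>I. (f i + e i - f i)\<^sup>2)"
      by (intro sum.cong) (auto simp: y f_def k'_iff)
    finally have "(\<Sum>i\<in>I. (h i - f i)\<^sup>2) \<le> 2 * (\<Sum>i\<in>I. e i * (h i - f i))"
      by (rule least_squares_basic_inequality)
    thus ?thesis by (simp add: g_def \<kappa>_def h_def f_def)
  qed
  have piece: "n x * (g x)\<^sup>2 \<le> 16 * L" for x
  proof -
    \<comment> \<open>Every class is the trace of an interval on the grid, which is what
      \<open>noise\<close> controls although \<open>j\<close> depends on the data. Reversed
      endpoints give the empty class.\<close>
    have "\<exists>u v. u \<le> N \<and> v \<le> N \<and> {i \<in> I. \<kappa> i = x} = I \<inter> {u<..v}" for x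
    proof -
      obtain p q where x: "x = (p, q)" by force
      have eq: "{i \<in> I. \<kappa> i = x} = I \<inter> {(if p then 0 else if q then k else max k j)<..
          (if p then if q then min k j else k else if q then j else N)}" if "p \<longrightarrow> q"
        using that unfolding x \<kappa>_def I_def by (cases p; cases q) auto
      have eq': "{i \<in> I. \<kappa> i = x} = I \<inter> {j<..k}" if "\<not> (p \<longrightarrow> q)"
        using that unfolding x \<kappa>_def by auto
      show ?thesis
      proof (cases "p \<longrightarrow> q")
        case True
        show ?thesis unfolding eq[OF True] using \<open>k < N\<close> jN
          by (intro exI conjI refl) auto
      next
        case False
        show ?thesis unfolding eq'[OF False] using \<open>k < N\<close> jN
          by (intro exI conjI refl) auto
      qed
    qed
    hence "\<bar>\<Sum>i | i \<in> I \<and> \<kappa> i = x. e i\<bar> \<le> sqrt (L * card {i \<in> I. \<kappa> i = x})" for x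
      using noise by metis
    hence "n x * (g x)\<^sup>2 \<le> 4 * card (UNIV :: (bool \<times> bool) set) * L"
      unfolding n_def using finI basic \<open>0 < L\<close>
      by (intro piecewise_constant_least_squares[where e = e]) auto
    thus ?thesis by simp
  qed
  have n_left: "n (True, True) + n (True, False) = k div s"
  proof -
    have "n (True, True) + n (True, False) = card ({i \<in> I. \<kappa> i = (True, True)} \<union> {i \<in> I. \<kappa> i = (True, False)})"
      unfolding n_def using finI by (subst card_Un_disjoint) auto
    also have "{i \<in> I. \<kappa> i = (True, True)} \<union> {i \<in> I. \<kappa> i = (True, False)} = {i. 0 < i \<and> i \<le> k \<and> s dvd i}"
      using \<open>k < N\<close> by (auto simp: \<kappa>_def I_def)
    finally show ?thesis using card_multiples[OF \<open>0 < s\<close>, of 0 k] by simp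
  qed
  have n_right: "n (False, True) + n (False, False) = real ((N - 1) div s) - real (k div s)"
  proof -
    have "n (False, True) + n (False, False) = card ({i \<in> I. \<kappa> i = (False, True)} \<union> {i \<in> I. \<kappa> i = (False, False)})"
      unfolding n_def using finI by (subst card_Un_disjoint) auto
    also have "{i \<in> I. \<kappa> i = (False, True)} \<union> {i \<in> I. \<kappa> i = (False, False)} = {i. k < i \<and> i \<le> N - 1 \<and> s dvd i}"
      using \<open>k < N\<close> by (auto simp: \<kappa>_def I_def)
    finally show ?thesis
      using card_multiples[OF \<open>0 < s\<close>, of k "N - 1"] \<open>k < N\<close> by (simp add: div_le_mono of_nat_diff)
  qed
  have n0: "0 \<le> n x" for x by (simp add: n_def)
  have pieces: "n (True, True) * (a - \<alpha>)\<^sup>2 \<le> 16 * L" "n (False, True) * (a - \<beta>)\<^sup>2 \<le> 16 * L"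
    "n (True, False) * (b - \<alpha>)\<^sup>2 \<le> 16 * L" "n (False, False) * (b - \<beta>)\<^sup>2 \<le> 16 * L"
    using piece[of "(True, True)"] piece[of "(False, True)"] piece[of "(True, False)"]
      piece[of "(False, False)"] by (simp_all add: g_def)
  have D2: "(\<beta> - \<alpha>)\<^sup>2 = (\<alpha> - \<beta>)\<^sup>2" "\<bar>\<beta> - \<alpha>\<bar> = \<bar>\<alpha> - \<beta>\<bar>" by (auto simp: power2_commute)
  \<comment> \<open>The least number of grid points that \<open>level_separation\<close> asks for on
    each side of \<open>k\<close>.\<close>
  define m where "m = 1088 * L / (\<alpha> - \<beta>)\<^sup>2"
  have m: "1088 * L \<le> m * (\<alpha> - \<beta>)\<^sup>2" "m \<le> k div s" "m \<le> real ((N - 1) div s) - real (k div s)"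
    using left right \<open>\<alpha> \<noteq> \<beta>\<close> by (auto simp: m_def pos_divide_le_eq)
  have j: "j = s * (j div s)" using jN by simp
  have k: "s * (k div s) \<le> k" "k \<le> s * (k div s + 1)"
    using \<open>0 < s\<close> dividend_less_times_div[of s k] by auto
  consider "k \<le> j" | "j < k" by linarith
  hence "\<bar>a - \<alpha>\<bar> \<le> \<bar>\<alpha> - \<beta>\<bar> / 8 \<and> \<bar>b - \<beta>\<bar> \<le> \<bar>\<alpha> - \<beta>\<bar> / 8 \<and>
    \<bar>real j - real k\<bar> \<le> s * (64 * L / (\<alpha> - \<beta>)\<^sup>2 + 1)"
  proof cases
    case 1
    have empty: "n (True, False) = 0" using 1 by (auto simp: n_def \<kappa>_def)
    note sep = level_separation[OF pieces(1,2,4) n0, of m]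
    have "n (False, True) = real (card {i. k < i \<and> i \<le> j \<and> s dvd i})"
      unfolding n_def by (rule arg_cong[where f = "\<lambda>x. real (card x)"])
        (use jN in \<open>auto simp: \<kappa>_def I_def\<close>)
    also have "\<dots> = real (j div s) - real (k div s)"
      using card_multiples[OF \<open>0 < s\<close>] 1 by (simp add: div_le_mono of_nat_diff)
    finally have nj: "n (False, True) = real (j div s) - real (k div s)" .
    have "real j - real k \<le> real s * (real (j div s) - real (k div s))"
      using j k(1) by (metis diff_left_mono of_nat_le_iff of_nat_mult right_diff_distrib)
    also have "\<dots> \<le> s * (64 * L / (\<alpha> - \<beta>)\<^sup>2)"
      unfolding nj[symmetric] using sep(3) m n_left n_right empty assms(5,6)
      by (intro mult_left_mono) auto
    finally have "\<bar>real j - real k\<bar> \<le> s * (64 * L / (\<alpha> - \<beta>)\<^sup>2 + 1)"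
      using 1 by (simp add: distrib_left)
    thus ?thesis using sep(1,2) m n_left n_right empty assms(5,6) by auto
  next
    case 2
    have empty: "n (False, True) = 0" using 2 by (auto simp: n_def \<kappa>_def)
    \<comment> \<open>Mirror image of the first case: now \<open>b\<close> is the level fitted on
      both sides of \<open>k\<close>, so the two levels exchange roles.\<close>
    note sep = level_separation[OF pieces(4,3,1) n0, of m, unfolded D2]
    have "n (True, False) = real (card {i. j < i \<and> i \<le> k \<and> s dvd i})"
      unfolding n_def by (rule arg_cong[where f = "\<lambda>x. real (card x)"])
        (use \<open>k < N\<close> in \<open>auto simp: \<kappa>_def I_def\<close>)
    also have "\<dots> = real (k div s) - real (j div s)"
      using card_multiples[OF \<open>0 < s\<close>] 2 by (simp add: div_le_mono of_nat_diff)
    finally have nj: "n (True, False) = real (k div s) - real (j div s)" .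
    \<comment> \<open>\<open>k\<close> may lie beyond the last grid point before it, whence the
      extra cell in the bound.\<close>
    have "real k \<le> real (s * (k div s + 1))" using k(2) by (simp only: of_nat_le_iff)
    moreover have "real j = real (s * (j div s))" using j by simp
    ultimately have "real k - real j \<le> real s * (real (k div s) - real (j div s) + 1)"
      by (simp add: algebra_simps)
    also have "\<dots> \<le> s * (64 * L / (\<alpha> - \<beta>)\<^sup>2 + 1)"
      unfolding nj[symmetric] using sep(3) m n_left n_right empty assms(5,6)
      by (intro mult_left_mono) auto
    finally have "\<bar>real j - real k\<bar> \<le> s * (64 * L / (\<alpha> - \<beta>)\<^sup>2 + 1)"
      using 2 by simp
    thus ?thesis using sep(1,2) m n_left n_right empty assms(5,6) by auto
  qed
  thus "\<bar>a - \<alpha>\<bar> \<le> \<bar>\<alpha> - \<beta>\<bar> / 8" "\<bar>b - \<beta>\<bar> \<le> \<bar>\<alpha> - \<beta>\<bar> / 8"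
    "\<bar>real j - real k\<bar> \<le> s * (64 * L / (\<alpha> - \<beta>)\<^sup>2 + 1)" by auto
qed

subsection \<open>Second stage\<close>

lemma residual_sum_shift:
  fixes y :: "nat \<Rightarrow> real"
  assumes "finite W" "u \<le> v"
  shows "(\<Sum>i\<in>W. (y i - (if i \<le> v then a else b))\<^sup>2) - (\<Sum>i\<in>W. (y i - (if i \<le> u then a else b))\<^sup>2)
    = (\<Sum>i\<in>W \<inter> {u<..v}. (y i - a)\<^sup>2 - (y i - b)\<^sup>2)"
  unfolding sum_subtractf[symmetric]
  by (subst sum.inter_restrict[OF assms(1)], rule sum.cong) (use assms in auto)

text \<open>\<open>\<theta>\<close> is the true level, \<open>b\<close> the right fitted level and
  \<open>a\<close> the wrong one. Each summand factors as
  \<open>(b - a) * ((2 * \<theta> - a - b) + 2 * e i)\<close>, where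
  \<open>2 * \<theta> - a - b\<close> has the sign of \<open>b - a\<close> and modulus at least half
  the jump. The wrong level can win only if the errors offset this drift.\<close>

lemma wrong_level_needs_noise:
  fixes a b \<theta> \<theta>' :: real
  assumes "(\<Sum>i\<in>A. (\<theta> + e i - a)\<^sup>2 - (\<theta> + e i - b)\<^sup>2) \<le> 0"
    and "\<bar>b - \<theta>\<bar> \<le> \<bar>\<theta>' - \<theta>\<bar> / 8" "\<bar>a - \<theta>'\<bar> \<le> \<bar>\<theta>' - \<theta>\<bar> / 8" "\<theta> \<noteq> \<theta>'"
  shows "\<bar>\<theta>' - \<theta>\<bar> / 4 * card A \<le> \<bar>\<Sum>i\<in>A. e i\<bar>"
proof -
  let ?n = "real (card A)" and ?E = "\<Sum>i\<in>A. e i"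
  have "(\<Sum>i\<in>A. (\<theta> + e i - a)\<^sup>2 - (\<theta> + e i - b)\<^sup>2) = (\<Sum>i\<in>A. (b - a) * ((2 * \<theta> - a - b) + 2 * e i))"
    by (intro sum.cong) (auto simp: power2_eq_square algebra_simps)
  also have "\<dots> = (b - a) * (?n * (2 * \<theta> - a - b) + 2 * ?E)"
    by (simp add: sum_distrib_left[symmetric] sum.distrib)
  finally have le: "(b - a) * (?n * (2 * \<theta> - a - b) + 2 * ?E) \<le> 0" using assms(1) by simp
  consider "\<theta>' < \<theta>" | "\<theta> < \<theta>'" using assms(4) by linarith
  thus ?thesis
  proof cases
    case 1
    hence D: "\<bar>\<theta>' - \<theta>\<bar> = \<theta> - \<theta>'" by simp
    have ab: "b - \<theta> \<le> (\<theta> - \<theta>') / 8" "\<theta> - b \<le> (\<theta> - \<theta>') / 8" "a - \<theta>' \<le> (\<theta> - \<theta>') / 8"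
      using abs_le_D1[OF assms(2)] abs_le_D2[OF assms(2)] abs_le_D1[OF assms(3)] D by argo+
    hence "0 < b - a" using 1 by argo
    hence "?n * (2 * \<theta> - a - b) + 2 * ?E \<le> 0" using le by (simp add: mult_le_0_iff)
    moreover have "?n * (\<bar>\<theta>' - \<theta>\<bar> / 2) \<le> ?n * (2 * \<theta> - a - b)"
      unfolding D using ab 1 by (intro mult_left_mono) (argo, simp)
    ultimately show ?thesis by (simp add: mult.commute)
  next
    case 2
    hence D: "\<bar>\<theta>' - \<theta>\<bar> = \<theta>' - \<theta>" by simp
    have ab: "\<theta> - b \<le> (\<theta>' - \<theta>) / 8" "b - \<theta> \<le> (\<theta>' - \<theta>) / 8" "\<theta>' - a \<le> (\<theta>' - \<theta>) / 8"
      using abs_le_D1[OF assms(2)] abs_le_D2[OF assms(2)] abs_le_D2[OF assms(3)] D by argo+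
    hence "b - a < 0" using 2 by argo
    hence "0 \<le> ?n * (2 * \<theta> - a - b) + 2 * ?E" using le by (simp add: mult_le_0_iff)
    moreover have "?n * (2 * \<theta> - a - b) \<le> ?n * - (\<bar>\<theta>' - \<theta>\<bar> / 2)"
      unfolding D using ab 2 by (intro mult_left_mono) (argo, simp)
    ultimately show ?thesis by (simp add: mult.commute)
  qed
qed

text \<open>Compared with a split at \<open>k\<close>, a split at \<open>j\<close> uses the wrong
  level exactly on the window points between them. If there are at least \<open>C\<close> steps
  between \<open>j\<close> and \<open>k\<close>, the noise bounds contradict
  \<open>wrong_level_needs_noise\<close>.\<close>

lemma fine_fit_close:
  fixes N k j C :: nat and W I :: "nat set" and e y :: "nat \<Rightarrow> real" and a b \<alpha> \<beta> lo hi :: real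
  defines "W \<equiv> {i. i \<in> {1..N} \<and> lo \<le> real i \<and> real i \<le> hi \<and> i \<notin> I}"
  assumes "j \<in> W" "\<alpha> \<noteq> \<beta>" "2 \<le> k" "k < N" "lo \<le> real k - 1" "real k \<le> hi"
    and sparse: "k \<notin> I \<or> k - 1 \<notin> I"
    and y: "\<And>i. i \<in> W \<Longrightarrow> y i = (if i \<le> k then \<alpha> else \<beta>) + e i"
    and min: "\<And>j'. j' \<in> W \<Longrightarrow>
      (\<Sum>i\<in>W. (y i - (if i \<le> j then a else b))\<^sup>2) \<le> (\<Sum>i\<in>W. (y i - (if i \<le> j' then a else b))\<^sup>2)"
    and close: "\<bar>a - \<alpha>\<bar> \<le> \<bar>\<alpha> - \<beta>\<bar> / 8" "\<bar>b - \<beta>\<bar> \<le> \<bar>\<alpha> - \<beta>\<bar> / 8"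
    and noise_right: "\<And>n. C \<le> n \<Longrightarrow> k + n \<le> N \<Longrightarrow>
      \<bar>\<Sum>i\<in>{k<..k + n} - I. e i\<bar> < \<bar>\<alpha> - \<beta>\<bar> / 4 * card ({k<..k + n} - I)"
    and noise_left: "\<And>n. C \<le> n \<Longrightarrow> n \<le> k \<Longrightarrow>
      \<bar>\<Sum>i\<in>{k - n<..k} - I. e i\<bar> < \<bar>\<alpha> - \<beta>\<bar> / 4 * card ({k - n<..k} - I)"
  shows "\<bar>real j - real k\<bar> < C"
proof -
  have finW: "finite W" unfolding W_def by (auto intro: finite_subset[of _ "{..N}"])
  have j: "1 \<le> j" "j \<le> N" "lo \<le> real j" "real j \<le> hi" using \<open>j \<in> W\<close> by (auto simp: W_def)
  \<comment> \<open>As above: \<open>k\<close> may be a first-stage point, which is excluded from \<open>W\<close>.\<close>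
  define j' where "j' = (if k \<in> I then k - 1 else k)"
  have j': "j' \<in> W" using assms(4-8) by (auto simp: W_def j'_def)
  have "i \<le> j' \<longleftrightarrow> i \<le> k" if "i \<in> W" for i
    using that by (cases "i = k") (auto simp: W_def j'_def)
  hence "(\<Sum>i\<in>W. (y i - (if i \<le> j' then a else b))\<^sup>2) = (\<Sum>i\<in>W. (y i - (if i \<le> k then a else b))\<^sup>2)"
    by (intro sum.cong) auto
  with min[OF j'] have le: "(\<Sum>i\<in>W. (y i - (if i \<le> j then a else b))\<^sup>2)
      \<le> (\<Sum>i\<in>W. (y i - (if i \<le> k then a else b))\<^sup>2)" by simp
  consider "k \<le> j" | "j < k" by linarith
  thus ?thesis
  proof cases
    case 1
    \<comment> \<open>Both \<open>k\<close> and \<open>j\<close> lie between \<open>lo\<close> and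
      \<open>hi\<close>, so the window disappears from the set of misfitted points. This allows
      noise events that do not refer to the first-stage fit.\<close>
    have W: "W \<inter> {k<..j} = {k<..j} - I" using j assms(4-7) by (auto simp: W_def)
    have "(\<Sum>i\<in>{k<..j} - I. (\<beta> + e i - a)\<^sup>2 - (\<beta> + e i - b)\<^sup>2)
        = (\<Sum>i\<in>W \<inter> {k<..j}. (y i - a)\<^sup>2 - (y i - b)\<^sup>2)"
      unfolding W[symmetric] by (intro sum.cong) (auto simp: y)
    also have "\<dots> \<le> 0" using residual_sum_shift[OF finW 1, of y a b] le by linarith
    finally have "\<bar>\<alpha> - \<beta>\<bar> / 4 * card ({k<..j} - I) \<le> \<bar>\<Sum>i\<in>{k<..j} - I. e i\<bar>"
      using close \<open>\<alpha> \<noteq> \<beta>\<close> by (intro wrong_level_needs_noise[where \<theta> = \<beta> and a = a and b = b]) auto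
    hence "\<not> C \<le> j - k" using noise_right[of "j - k"] 1 j by auto
    thus ?thesis using 1 by linarith
  next
    case 2
    have W: "W \<inter> {j<..k} = {j<..k} - I" using j assms(4-7) by (auto simp: W_def)
    \<comment> \<open>To the left of \<open>k\<close> the wrong level is \<open>b\<close>, so the
      two levels are exchanged and the sign flips.\<close>
    have "(\<Sum>i\<in>{j<..k} - I. (\<alpha> + e i - b)\<^sup>2 - (\<alpha> + e i - a)\<^sup>2)
        = - (\<Sum>i\<in>W \<inter> {j<..k}. (y i - a)\<^sup>2 - (y i - b)\<^sup>2)"
      unfolding W[symmetric] sum_negf[symmetric] by (intro sum.cong) (auto simp: y)
    also have "\<dots> \<le> 0" using residual_sum_shift[OF finW, of j k y a b] 2 le by linarith
    finally have "\<bar>\<beta> - \<alpha>\<bar> / 4 * card ({j<..k} - I) \<le> \<bar>\<Sum>i\<in>{j<..k} - I. e i\<bar>"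
      using close \<open>\<alpha> \<noteq> \<beta>\<close> by (intro wrong_level_needs_noise[where \<theta> = \<alpha> and a = b and b = a]) (auto simp: abs_minus_commute)
    hence "\<not> C \<le> k - j" using noise_left[of "k - j"] 2 j by (auto simp: abs_minus_commute)
    thus ?thesis using 2 by linarith
  qed
qed

subsection \<open>The two-stage estimator\<close>

lemma real_div_ge: "0 < s \<Longrightarrow> real n / real s - 1 \<le> real (n div s)"
proof -
  assume "0 < s"
  hence "n \<le> s * (n div s + 1)" using dividend_less_times_div[of s n] by simp
  hence "real n \<le> real s * (real (n div s) + 1)" by (metis of_nat_1 of_nat_add of_nat_le_iff of_nat_mult)
  thus ?thesis using \<open>0 < s\<close> by (simp add: pos_divide_le_eq diff_le_eq mult.commute)
qed

lemma rss_grid_image: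
  assumes "0 < N" "J \<subseteq> {1..N}"
  shows "rss N ((\<lambda>i. real i / real N) ` J) y a b (real j / real N)
    = (\<Sum>i\<in>J. (y i - (if i \<le> j then a else b))\<^sup>2)"
proof -
  have "{i. i \<in> {1..N} \<and> real i / real N \<in> (\<lambda>i. real i / real N) ` J} = J"
    using assms by (auto simp: field_simps)
  thus ?thesis unfolding rss_def stump_def using assms(1)
    by (auto intro!: sum.cong simp: divide_le_cancel divide_less_cancel)
qed

text \<open>Deterministic core, for one fixed realization of the errors. \<open>\<rho>\<close> is
  the grid spacing before rounding. The hypotheses \<open>left\<close> and \<open>right\<close>
  provide enough grid points on each side of \<open>\<tau>\<close>, and \<open>window\<close> makes
  the second-stage window wider than the first-stage error.\<close>

lemma two_stage_error_le:
  fixes N C :: nat and e y :: "nat \<Rightarrow> real" and \<alpha> \<beta> \<tau> \<gamma> \<delta> K1 K2 L :: real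
  defines "I \<equiv> stage1_idx K1 \<gamma> N" and "k \<equiv> nat \<lfloor>real N * \<tau>\<rfloor>"
    and "\<rho> \<equiv> real N / (K1 * real N powr \<gamma>)"
  assumes est: "stage1_estimator K1 \<gamma> est1" "stage2_estimator K1 K2 \<gamma> \<delta> est1 est2"
    and y: "\<And>i. i \<in> {1..N} \<Longrightarrow> y i = stump \<alpha> \<beta> \<tau> (real i / real N) + e i"
    and "\<alpha> \<noteq> \<beta>" "0 < \<tau>" "\<tau> < 1" "0 < L"
    and "2 \<le> \<rho>" "3 \<le> real N * \<tau>" "3 \<le> real N * (1 - \<tau>)"
    and left: "1088 * L \<le> ((real N * \<tau> - 1) / \<rho> - 1) * (\<alpha> - \<beta>)\<^sup>2"
    and right: "1088 * L \<le> ((real N * (1 - \<tau>) - 1) / \<rho> - 1) * (\<alpha> - \<beta>)\<^sup>2"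
    and window: "\<rho> * (64 * L / (\<alpha> - \<beta>)\<^sup>2 + 1) + 3 \<le> real N * (K2 * real N powr (- \<gamma> + \<delta>))"
    and noise: "\<And>u v. u \<le> N \<Longrightarrow> v \<le> N \<Longrightarrow>
      \<bar>\<Sum>i\<in>I \<inter> {u<..v}. e i\<bar> \<le> sqrt (L * card (I \<inter> {u<..v}))"
    and noise_right: "\<And>n. C \<le> n \<Longrightarrow> k + n \<le> N \<Longrightarrow>
      \<bar>\<Sum>i\<in>{k<..k + n} - I. e i\<bar> < \<bar>\<alpha> - \<beta>\<bar> / 4 * card ({k<..k + n} - I)"
    and noise_left: "\<And>n. C \<le> n \<Longrightarrow> n \<le> k \<Longrightarrow>
      \<bar>\<Sum>i\<in>{k - n<..k} - I. e i\<bar> < \<bar>\<alpha> - \<beta>\<bar> / 4 * card ({k - n<..k} - I)"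
  shows "\<bar>est2 N (restrict y {1..N}) - real_of_int \<lfloor>real N * \<tau>\<rfloor> / real N\<bar> \<le> real C / real N"
proof -
  define s where "s = nat \<lfloor>\<rho>\<rfloor>"
  define w where "w = K2 * real N powr (- \<gamma> + \<delta>)"
  have "0 < N" using \<open>3 \<le> real N * \<tau>\<close> by (intro gr0I) auto
  have s: "2 \<le> s" "real s \<le> \<rho>" using \<open>2 \<le> \<rho>\<close> unfolding s_def by (simp_all add: le_nat_floor)
  hence "0 < s" "0 < \<rho>" using \<open>2 \<le> \<rho>\<close> by auto
  have floor: "real_of_int \<lfloor>real N * \<tau>\<rfloor> = real k"
    using \<open>3 \<le> real N * \<tau>\<close> by (simp add: k_def)
  have k_real: "real k \<le> real N * \<tau>" "real N * \<tau> - 1 \<le> real k"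
    using floor by linarith+
  have "3 \<le> k" using \<open>3 \<le> real N * \<tau>\<close> unfolding k_def by (simp add: le_nat_floor)
  have "k < N"
  proof -
    have "real N * \<tau> < real N" using \<open>0 < N\<close> \<open>\<tau> < 1\<close> by simp
    thus ?thesis using k_real by linarith
  qed
  have I: "I = {i. 0 < i \<and> i < N \<and> s dvd i}" unfolding I_def stage1_idx_def s_def \<rho>_def ..
  have IN: "I \<subseteq> {1..N}" unfolding I by auto
  \<comment> \<open>At design points the jump at \<open>\<tau>\<close> is a jump after index
    \<open>k\<close>, so only integer indices occur from here on.\<close>
  have at_most_\<tau>: "real i / real N \<le> \<tau> \<longleftrightarrow> i \<le> k" for i
  proof -
    have "real i / real N \<le> \<tau> \<longleftrightarrow> real i \<le> real N * \<tau>"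
      using \<open>0 < N\<close> by (simp add: pos_divide_le_eq mult.commute)
    also have "\<dots> \<longleftrightarrow> i \<le> k" unfolding k_def by (simp add: nat_le_iff le_floor_iff le_nat_iff \<open>0 < \<tau>\<close> less_imp_le)
    finally show ?thesis .
  qed
  have y': "y i = (if i \<le> k then \<alpha> else \<beta>) + e i" if "i \<in> {1..N}" for i
    using y[OF that] at_most_\<tau>[of i] by (auto simp: stump_def not_le[symmetric])
  have grid1: "stage1_grid K1 \<gamma> N = (\<lambda>i. real i / real N) ` I"
    unfolding stage1_grid_def I_def ..

  \<comment> \<open>Rounding the spacing down to \<open>s\<close> can only add grid points; the two
    losses of 1 come from the floor in \<open>k\<close> and from the integer division.\<close>
  have k_div: "(real N * \<tau> - 1) / \<rho> - 1 \<le> real (k div s)"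
  proof -
    have "(real N * \<tau> - 1) / \<rho> \<le> (real N * \<tau> - 1) / s"
      using s \<open>0 < s\<close> \<open>3 \<le> real N * \<tau>\<close> \<open>0 < \<rho>\<close> by (intro divide_left_mono) auto
    also have "\<dots> \<le> real k / s" using k_real by (intro divide_right_mono) auto
    finally show ?thesis using real_div_ge[OF \<open>0 < s\<close>, of k] by linarith
  qed
  have k_div': "(real N * (1 - \<tau>) - 1) / \<rho> - 1 \<le> real ((N - 1) div s) - real (k div s)"
  proof -
    have "(real N * (1 - \<tau>) - 1) / \<rho> \<le> (real N * (1 - \<tau>) - 1) / s"
      using s \<open>0 < s\<close> \<open>3 \<le> real N * (1 - \<tau>)\<close> \<open>0 < \<rho>\<close> by (intro divide_left_mono) auto
    also have "\<dots> \<le> (real (N - 1) - real k) / s"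
      using k_real \<open>0 < N\<close> by (intro divide_right_mono) (auto simp: algebra_simps of_nat_diff)
    also have "\<dots> = real (N - 1) / s - real k / s" by (rule diff_divide_distrib)
    finally show ?thesis
      using real_div_ge[OF \<open>0 < s\<close>, of "N - 1"] of_nat_div_le_of_nat[of k s, where ?'a = real] by linarith
  qed
  have left': "1088 * L \<le> real (k div s) * (\<alpha> - \<beta>)\<^sup>2"
    using left mult_right_mono[OF k_div, of "(\<alpha> - \<beta>)\<^sup>2"] by simp
  have right': "1088 * L \<le> (real ((N - 1) div s) - real (k div s)) * (\<alpha> - \<beta>)\<^sup>2"
    using right mult_right_mono[OF k_div', of "(\<alpha> - \<beta>)\<^sup>2"] by simp

  obtain a b t where abt: "est1 N (restrict y I) = (a, b, t)" by (cases "est1 N (restrict y I)")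
  \<comment> \<open>The first-stage estimator is constrained only on a nonempty grid, so a grid
    point is exhibited: \<open>s\<close> itself, as \<open>s \<le> k < N\<close>.\<close>
  have "0 < k div s" using left' \<open>0 < L\<close> by (intro gr0I) auto
  hence "s \<in> I" using \<open>0 < s\<close> \<open>k < N\<close> by (auto simp: I div_greater_zero_iff)
  hence "stage1_grid K1 \<gamma> N \<noteq> {}" unfolding grid1 by blast
  hence "\<forall>y. is_arg_min (\<lambda>(a, b, t). rss N (stage1_grid K1 \<gamma> N) y a b t)
      (\<lambda>(a, b, t). t \<in> {0<..<1} \<and> t \<in> stage1_grid K1 \<gamma> N) (est1 N (restrict y I))"
    using est(1) unfolding stage1_estimator_def I_def by blast
  from spec[OF this, of y] have argmin1: "is_arg_min (\<lambda>(a, b, t). rss N (stage1_grid K1 \<gamma> N) y a b t)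
      (\<lambda>(a, b, t). t \<in> {0<..<1} \<and> t \<in> stage1_grid K1 \<gamma> N) (a, b, t)"
    unfolding abt .
  then obtain j where j: "j \<in> I" "t = real j / real N"
    unfolding is_arg_min_def grid1 by auto
  have min1: "(\<Sum>i\<in>I. (y i - (if i \<le> j then a else b))\<^sup>2)
      \<le> (\<Sum>i\<in>I. (y i - (if i \<le> j' then a' else b'))\<^sup>2)" if "j' \<in> I" for a' b' j'
  proof -
    have "real j' / real N \<in> {0<..<1}" using that by (auto simp: I)
    hence "rss N (stage1_grid K1 \<gamma> N) y a b t
        \<le> rss N (stage1_grid K1 \<gamma> N) y a' b' (real j' / real N)"
      using argmin1[unfolded is_arg_min_linorder] that
      by (auto simp: grid1 dest: spec[of _ "(a', b', real j' / real N)"])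
    thus ?thesis unfolding grid1 j(2) rss_grid_image[OF \<open>0 < N\<close> IN] .
  qed
  have y_I: "y i = (if i \<le> k then \<alpha> else \<beta>) + e i" if "i \<in> I" for i
    using that IN by (intro y') auto
  note coarse = coarse_fit_close[where s = s and k = k and j = j and N = N and y = y and e = e
    and a = a and b = b and \<alpha> = \<alpha> and \<beta> = \<beta> and L = L, folded I,
    OF \<open>0 < s\<close> \<open>k < N\<close> j(1) \<open>\<alpha> \<noteq> \<beta>\<close> \<open>0 < L\<close> y_I min1 noise left' right']
  note close = coarse(1,2)
  have jk: "\<bar>real j - real k\<bar> \<le> real N * w - 3"
  proof -
    have "\<bar>real j - real k\<bar> \<le> s * (64 * L / (\<alpha> - \<beta>)\<^sup>2 + 1)" by (rule coarse(3))
    also have "\<dots> \<le> \<rho> * (64 * L / (\<alpha> - \<beta>)\<^sup>2 + 1)"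
      using s \<open>0 < L\<close> by (intro mult_right_mono) auto
    finally show ?thesis using window unfolding w_def by linarith
  qed

  define lo hi where "lo = real j - real N * w" and "hi = real j + real N * w"
  \<comment> \<open>The window must also reach \<open>k - 1\<close>, which replaces \<open>k\<close>
    as competitor when \<open>k\<close> is a first-stage point.\<close>
  have lohi: "lo \<le> real k - 1" "real k \<le> hi" using jk unfolding lo_def hi_def by linarith+
  define W where "W = {i. i \<in> {1..N} \<and> lo \<le> real i \<and> real i \<le> hi \<and> i \<notin> I}"
  have WN: "W \<subseteq> {1..N}" unfolding W_def by auto
  have grid2: "stage2_grid K1 K2 \<gamma> \<delta> N t = (\<lambda>i. real i / real N) ` W"
  proof -
    have "t - w = lo / real N" "t + w = hi / real N"
      using \<open>0 < N\<close> by (auto simp: j(2) lo_def hi_def diff_divide_distrib add_divide_distrib)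
    hence in_window: "real i / real N \<in> {t - w..t + w} \<longleftrightarrow> lo \<le> real i \<and> real i \<le> hi" for i
      using \<open>0 < N\<close> by (simp add: divide_le_cancel)
    have in_grid1: "real i / real N \<in> (\<lambda>i. real i / real N) ` I \<longleftrightarrow> i \<in> I" for i
      using \<open>0 < N\<close> by auto
    have "stage2_grid K1 K2 \<gamma> \<delta> N t = {real i / real N |i. i \<in> W}"
      by (simp only: stage2_grid_def grid1 w_def[symmetric] in_window in_grid1 W_def mem_Collect_eq conj_assoc)
    thus ?thesis by (simp only: Setcompr_eq_image Collect_mem_eq)
  qed
  \<comment> \<open>Two consecutive integers cannot both be multiples of \<open>s >= 2\<close>. So
    the second-stage grid is nonempty and contains a point that splits it as \<open>k\<close>
    does.\<close>
  have sparse: "k \<notin> I \<or> k - 1 \<notin> I"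
  proof (rule ccontr)
    assume "\<not> ?thesis"
    hence "s dvd k" "s dvd k - 1" unfolding I by blast+
    hence "s dvd k - (k - 1)" by (rule dvd_diff_nat)
    thus False using s(1) \<open>3 \<le> k\<close> by simp
  qed
  hence "k \<in> W \<or> k - 1 \<in> W" using lohi \<open>3 \<le> k\<close> \<open>k < N\<close> by (auto simp: W_def)
  hence "stage2_grid K1 K2 \<gamma> \<delta> N t \<noteq> {}" unfolding grid2 by blast
  moreover note est(2)[unfolded stage2_estimator_def, THEN spec[of _ N], THEN conjunct2,
    THEN spec[of _ y], folded I_def, unfolded abt prod.case]
  ultimately have argmin2: "is_arg_min (rss N (stage2_grid K1 K2 \<gamma> \<delta> N t) y a b)
      (\<lambda>d. d \<in> stage2_grid K1 K2 \<gamma> \<delta> N t) (est2 N (restrict y {1..N}))"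
    by (rule rev_mp)
  then obtain j2 where j2: "j2 \<in> W" "est2 N (restrict y {1..N}) = real j2 / real N"
    unfolding is_arg_min_def grid2 by auto
  have min2: "(\<Sum>i\<in>W. (y i - (if i \<le> j2 then a else b))\<^sup>2)
      \<le> (\<Sum>i\<in>W. (y i - (if i \<le> j' then a else b))\<^sup>2)" if "j' \<in> W" for j'
  proof -
    have "rss N (stage2_grid K1 K2 \<gamma> \<delta> N t) y a b (real j2 / real N)
        \<le> rss N (stage2_grid K1 K2 \<gamma> \<delta> N t) y a b (real j' / real N)"
      using argmin2[unfolded is_arg_min_linorder j2(2)] that by (auto simp: grid2)
    thus ?thesis unfolding grid2 rss_grid_image[OF \<open>0 < N\<close> WN] .
  qed
  have "\<bar>real j2 - real k\<bar> < C"
    using fine_fit_close[of j2 N lo hi I \<alpha> \<beta> k y e a b C] j2(1) min2 sparse lohi close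
      \<open>\<alpha> \<noteq> \<beta>\<close> \<open>3 \<le> k\<close> \<open>k < N\<close> y' noise_right noise_left unfolding W_def by simp
  moreover have "\<bar>real j2 / real N - real k / real N\<bar> = \<bar>real j2 - real k\<bar> / real N"
    by (simp add: diff_divide_distrib[symmetric] abs_divide)
  ultimately show ?thesis unfolding floor j2(2) by (simp add: divide_right_mono)
qed

section \<open>Choice of rates and the probability bound\<close>

theorem theorem1:
  fixes M :: "'a measure"
    and \<epsilon> Y :: "nat \<Rightarrow> nat \<Rightarrow> 'a \<Rightarrow> real"
    and \<alpha> \<beta> \<tau> \<sigma> \<gamma> \<delta> K1 K2 :: real
    and est1 :: "nat \<Rightarrow> (nat \<Rightarrow> real) \<Rightarrow> real \<times> real \<times> real"
    and est2 :: "nat \<Rightarrow> (nat \<Rightarrow> real) \<Rightarrow> real"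
  assumes "prob_space M"
    and "0 < \<gamma>" "\<gamma> < 1" "0 < K1" "0 < K2" "0 < \<delta>" "\<delta> < \<gamma>"
    and "0 < \<sigma>" "\<alpha> \<noteq> \<beta>" "0 < \<tau>" "\<tau> < 1"
    and "\<And>N. prob_space.indep_vars M (\<lambda>_. borel) (\<epsilon> N) {1..N}"
    and "\<And>N i. i \<in> {1..N} \<Longrightarrow> distributed M lborel (\<epsilon> N i) (normal_density 0 \<sigma>)"
    and "\<And>N i \<omega>. i \<in> {1..N} \<Longrightarrow> Y N i \<omega> = stump \<alpha> \<beta> \<tau> (real i / real N) + \<epsilon> N i \<omega>"
    and "stage1_estimator K1 \<gamma> est1"
    and "stage2_estimator K1 K2 \<gamma> \<delta> est1 est2"
  shows "big_O_p M
           (\<lambda>N \<omega>. \<bar>est2 N (\<lambda>i\<in>{1..N}. Y N i \<omega>) - real_of_int \<lfloor>real N * \<tau>\<rfloor> / real N\<bar>)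
           (\<lambda>N. 1 / real N)"
proof -
  interpret prob_space M by fact
  define D where "D = \<bar>\<alpha> - \<beta>\<bar>"
  have "0 < D" and D2: "(\<alpha> - \<beta>)\<^sup>2 = D\<^sup>2" using \<open>\<alpha> \<noteq> \<beta>\<close> by (auto simp: D_def)
  \<comment> \<open>The ratio in \<open>prob_exists_linear_sum_ge\<close> for the slope
    \<open>c = D / 4\<close> required by \<open>fine_fit_close\<close>.\<close>
  define q where "q = exp (- (D / 4)\<^sup>2 / (4 * \<sigma>\<^sup>2))"
  have q: "0 < q" "q < 1" unfolding q_def using \<open>0 < D\<close> \<open>0 < \<sigma>\<close> by auto
  define I where "I N = stage1_idx K1 \<gamma> N" for N
  define s where "s N = nat \<lfloor>real N / (K1 * real N powr \<gamma>)\<rfloor>" for N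
  define k where "k N = nat \<lfloor>real N * \<tau>\<rfloor>" for N
  \<comment> \<open>Any positive power of \<open>N\<close> makes the exponential beat the
    \<open>(N + 1)^2\<close> sets. The exponent \<open>\<delta> / 2\<close> is below
    \<open>\<gamma>\<close>, so the grid has enough points, and below \<open>\<delta>\<close>, so
    \<open>L\<close> grid cells fit into the second-stage window.\<close>
  define L where "L N = real N powr (\<delta> / 2)" for N :: nat
  define X where "X N \<omega> = \<bar>est2 N (\<lambda>i\<in>{1..N}. Y N i \<omega>) - real_of_int \<lfloor>real N * \<tau>\<rfloor> / real N\<bar>" for N \<omega>
  note indep = assms(12) and normal = assms(13) and Y = assms(14)

  have "X N \<in> borel_measurable M" for N
  proof -
    have "Y N i \<in> borel_measurable M" if "i \<in> {1..N}" for i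
    proof -
      have "Y N i = (\<lambda>\<omega>. stump \<alpha> \<beta> \<tau> (real i / real N) + \<epsilon> N i \<omega>)" using Y[OF that] by blast
      moreover have "\<epsilon> N i \<in> borel_measurable M"
        using distributed_measurable[OF normal[OF that]] by simp
      ultimately show ?thesis by simp
    qed
    hence "(\<lambda>\<omega>. \<lambda>i\<in>{1..N}. Y N i \<omega>) \<in> measurable M (PiM {1..N} (\<lambda>_. borel))"
      by (intro measurable_restrict)
    moreover have "est2 N \<in> borel_measurable (PiM {1..N} (\<lambda>_. borel))"
      using assms(16) unfolding stage2_estimator_def by blast
    ultimately have "(\<lambda>\<omega>. est2 N (\<lambda>i\<in>{1..N}. Y N i \<omega>)) \<in> borel_measurable M"
      by (rule measurable_compose)
    thus ?thesis unfolding X_def by measurable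
  qed
  moreover have "\<exists>C. \<forall>\<^sub>F N in sequentially. prob {\<omega> \<in> space M. \<bar>X N \<omega>\<bar> > C * \<bar>1 / real N\<bar>} < \<eta>"
    if "0 < \<eta>" for \<eta>
  proof -
    \<comment> \<open>\<open>C\<close> is fixed before \<open>N\<close>: the geometric tails do not
      depend on \<open>N\<close>. Each of the three exceptional events receives a third of
      \<open>\<eta>\<close>.\<close>
    have "(\<lambda>C. 2 * q ^ C / (1 - q)) \<longlonglongrightarrow> 2 * 0 / (1 - q)"
      using q by (intro tendsto_intros LIMSEQ_realpow_zero) auto
    hence "\<forall>\<^sub>F C in sequentially. 2 * q ^ C / (1 - q) < \<eta> / 3"
      using \<open>0 < \<eta>\<close> by (intro order_tendstoD) auto
    then obtain C0 where "\<forall>C\<ge>C0. 2 * q ^ C / (1 - q) < \<eta> / 3"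
      unfolding eventually_sequentially by blast
    hence C0: "2 * q ^ (C0 + 1) / (1 - q) < \<eta> / 3" by (rule allE[of _ "C0 + 1"]) simp
    define C where "C = C0 + 2"
    have C: "2 \<le> C" "2 * q ^ (C - 1) / (1 - q) < \<eta> / 3" using C0 by (simp_all add: C_def)

    define \<A> where "\<A> N = (\<lambda>(u, v). I N \<inter> {u<..v}) ` ({..N} \<times> {..N}) - {{}}" for N
    define F1 where "F1 N n = {k N<..k N + n} - I N" for N n
    define F2 where "F2 N n = {k N - n<..k N} - I N" for N n
    define R1 where "R1 N = {n. C \<le> n \<and> k N + n \<le> N}" for N
    define R2 where "R2 N = {n. C \<le> n \<and> n \<le> k N}" for N
    define B0 where "B0 N = {\<omega> \<in> space M. \<exists>A\<in>\<A> N. sqrt (L N * card A) \<le> \<bar>\<Sum>i\<in>A. \<epsilon> N i \<omega>\<bar>}" for N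
    define B1 where "B1 N = {\<omega> \<in> space M. \<exists>A\<in>F1 N ` R1 N. D / 4 * card A \<le> \<bar>\<Sum>i\<in>A. \<epsilon> N i \<omega>\<bar>}" for N
    define B2 where "B2 N = {\<omega> \<in> space M. \<exists>A\<in>F2 N ` R2 N. D / 4 * card A \<le> \<bar>\<Sum>i\<in>A. \<epsilon> N i \<omega>\<bar>}" for N

    \<comment> \<open>The first six asymptotic facts are the numerical hypotheses of
      \<open>two_stage_error_le\<close>; the seventh makes the first-stage noise event
      unlikely.\<close>
    have "\<forall>\<^sub>F N in sequentially. 2 \<le> real N / (K1 * real N powr \<gamma>)"
      using assms(2-7) by real_asymp
    moreover have "\<forall>\<^sub>F N in sequentially. 3 \<le> real N * \<tau>"
      using \<open>0 < \<tau>\<close> by real_asymp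
    moreover have "\<forall>\<^sub>F N in sequentially. 3 \<le> real N * (1 - \<tau>)"
      using \<open>\<tau> < 1\<close> by real_asymp
    moreover have "\<forall>\<^sub>F N in sequentially. 1088 * real N powr (\<delta> / 2)
        \<le> ((real N * \<tau> - 1) / (real N / (K1 * real N powr \<gamma>)) - 1) * D\<^sup>2"
      using assms(2-7) \<open>0 < \<tau>\<close> \<open>0 < D\<close> by real_asymp
    moreover have "\<forall>\<^sub>F N in sequentially. 1088 * real N powr (\<delta> / 2)
        \<le> ((real N * (1 - \<tau>) - 1) / (real N / (K1 * real N powr \<gamma>)) - 1) * D\<^sup>2"
      using assms(2-7) \<open>\<tau> < 1\<close> \<open>0 < D\<close> by real_asymp
    moreover have "\<forall>\<^sub>F N in sequentially. real N / (K1 * real N powr \<gamma>)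
        * (64 * real N powr (\<delta> / 2) / D\<^sup>2 + 1) + 3 \<le> real N * (K2 * real N powr (- \<gamma> + \<delta>))"
      using assms(2-7) \<open>0 < D\<close> by real_asymp
    moreover have "\<forall>\<^sub>F N in sequentially.
        2 * (real N + 1)\<^sup>2 * exp (- (real N powr (\<delta> / 2)) / (2 * \<sigma>\<^sup>2)) < \<eta> / 3"
      using \<open>0 < \<delta>\<close> \<open>0 < \<sigma>\<close> \<open>0 < \<eta>\<close> by real_asymp
    ultimately have "\<forall>\<^sub>F N in sequentially.
        prob {\<omega> \<in> space M. \<bar>X N \<omega>\<bar> > real C * \<bar>1 / real N\<bar>} < \<eta>"
    proof eventually_elim
      case (elim N)
      note large = elim
      have "0 < N" using large(2) by (intro gr0I) auto
      have "0 < L N" using \<open>0 < N\<close> by (simp add: L_def)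
      have "2 \<le> s N" using large(1) by (simp add: s_def le_nat_floor)
      have "k N < N"
      proof -
        have "real N * \<tau> < real N" using \<open>0 < N\<close> \<open>\<tau> < 1\<close> by simp
        thus ?thesis using \<open>0 < \<tau>\<close> unfolding k_def
          by (subst nat_less_iff) (auto simp: floor_less_iff)
      qed
      have I: "I N = {i. 0 < i \<and> i < N \<and> s N dvd i}"
        unfolding I_def stage1_idx_def s_def ..
      \<comment> \<open>Only an inclusion is available, since \<open>I N\<close> stops before
        \<open>N\<close> and so omits some multiples of \<open>s N\<close>; it goes in the required
        direction.\<close>
      have gap: "v - u \<le> 2 * card ({u<..v} - I N) + 1" for u v
      proof -
        have "card {i. u < i \<and> i \<le> v \<and> \<not> s N dvd i} \<le> card ({u<..v} - I N)"
          by (intro card_mono) (auto simp: I)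
        thus ?thesis using card_nonmultiples_ge[OF \<open>2 \<le> s N\<close>, of v u] by linarith
      qed
      have F1: "F1 N n \<subseteq> {1..N} \<and> C \<le> n \<and> n \<le> 2 * card (F1 N n) + 1" if "n \<in> R1 N" for n
        using gap[of "k N + n" "k N"] that by (auto simp: F1_def R1_def)
      have F2: "F2 N n \<subseteq> {1..N} \<and> C \<le> n \<and> n \<le> 2 * card (F2 N n) + 1" if "n \<in> R2 N" for n
        using gap[of "k N" "k N - n"] that \<open>k N < N\<close> by (auto simp: F2_def R2_def)
      have "finite (R1 N)" "finite (R2 N)"
        unfolding R1_def R2_def by (auto intro: finite_subset[of _ "{..N}"])
      have "0 < D / 4" using \<open>0 < D\<close> by simp
      have "I N \<subseteq> {1..N}" by (auto simp: I)
      note B0 = prob_exists_interval_sum_ge[OF indep this normal \<open>0 < \<sigma>\<close> less_imp_le[OF \<open>0 < L N\<close>],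
          folded \<A>_def, folded B0_def]
      note B1 = prob_exists_linear_sum_ge[OF indep F1 \<open>finite (R1 N)\<close> C(1) normal \<open>0 < \<sigma>\<close> \<open>0 < D / 4\<close>,
          folded q_def, folded B1_def]
      note B2 = prob_exists_linear_sum_ge[OF indep F2 \<open>finite (R2 N)\<close> C(1) normal \<open>0 < \<sigma>\<close> \<open>0 < D / 4\<close>,
          folded q_def, folded B2_def]

      \<comment> \<open>Off the three events the deterministic bound applies to each outcome
        separately: \<open>B0\<close> governs the first stage, \<open>B1\<close> and
        \<open>B2\<close> the second stage to the right and left of \<open>k N\<close>.\<close>
      have "X N \<omega> \<le> real C / real N" if \<omega>: "\<omega> \<in> space M" "\<omega> \<notin> B0 N" "\<omega> \<notin> B1 N" "\<omega> \<notin> B2 N" for \<omega>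
      proof -
        have noise: "\<bar>\<Sum>i\<in>I N \<inter> {u<..v}. \<epsilon> N i \<omega>\<bar> \<le> sqrt (L N * card (I N \<inter> {u<..v}))"
          if "u \<le> N" "v \<le> N" for u v
        proof (cases "I N \<inter> {u<..v} = {}")
          case False
          hence "I N \<inter> {u<..v} \<in> \<A> N" using that by (force simp: \<A>_def)
          hence "\<not> sqrt (L N * card (I N \<inter> {u<..v})) \<le> \<bar>\<Sum>i\<in>I N \<inter> {u<..v}. \<epsilon> N i \<omega>\<bar>"
            using \<omega>(1,2) unfolding B0_def by blast
          thus ?thesis by simp
        qed simp
        have noise_right: "\<bar>\<Sum>i\<in>F1 N n. \<epsilon> N i \<omega>\<bar> < D / 4 * card (F1 N n)"
          if "C \<le> n" "k N + n \<le> N" for n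
        proof -
          have "F1 N n \<in> F1 N ` R1 N" using that by (simp add: R1_def)
          hence "\<not> D / 4 * card (F1 N n) \<le> \<bar>\<Sum>i\<in>F1 N n. \<epsilon> N i \<omega>\<bar>"
            using \<omega>(1,3) unfolding B1_def by blast
          thus ?thesis by simp
        qed
        have noise_left: "\<bar>\<Sum>i\<in>F2 N n. \<epsilon> N i \<omega>\<bar> < D / 4 * card (F2 N n)"
          if "C \<le> n" "n \<le> k N" for n
        proof -
          have "F2 N n \<in> F2 N ` R2 N" using that by (simp add: R2_def)
          hence "\<not> D / 4 * card (F2 N n) \<le> \<bar>\<Sum>i\<in>F2 N n. \<epsilon> N i \<omega>\<bar>"
            using \<omega>(1,4) unfolding B2_def by blast
          thus ?thesis by simp
        qed
        have "\<bar>est2 N (restrict (\<lambda>i. Y N i \<omega>) {1..N})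
            - real_of_int \<lfloor>real N * \<tau>\<rfloor> / real N\<bar> \<le> real C / real N"
          by (rule two_stage_error_le[where e = "\<lambda>i. \<epsilon> N i \<omega>" and y = "\<lambda>i. Y N i \<omega>"
                and N = N and C = C and \<alpha> = \<alpha> and \<beta> = \<beta> and \<tau> = \<tau> and L = "L N",
                OF assms(15,16) Y assms(9-11) \<open>0 < L N\<close> large(1-3)
                  large(4-6)[folded L_def D2] noise[unfolded I_def]
                  noise_right[unfolded F1_def I_def k_def D_def]
                  noise_left[unfolded F2_def I_def k_def D_def]])
        thus ?thesis unfolding X_def by simp
      qed
      hence "{\<omega> \<in> space M. \<bar>X N \<omega>\<bar> > real C * \<bar>1 / real N\<bar>} \<subseteq> B0 N \<union> B1 N \<union> B2 N"
        by (force simp: X_def not_le[symmetric])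
      hence "prob {\<omega> \<in> space M. \<bar>X N \<omega>\<bar> > real C * \<bar>1 / real N\<bar>} \<le> prob (B0 N \<union> B1 N \<union> B2 N)"
        using B0(1) B1(1) B2(1) by (intro finite_measure_mono) auto
      also have "\<dots> \<le> prob (B0 N) + prob (B1 N) + prob (B2 N)"
        using measure_Un_le[of "B0 N \<union> B1 N" M "B2 N"] measure_Un_le[of "B0 N" M "B1 N"]
          B0(1) B1(1) B2(1) by auto
      also have "\<dots> < \<eta>" using B0(2) B1(2) B2(2) C(2) large(7) unfolding L_def by linarith
      finally show ?case .
    qed
    thus ?thesis by blast
  qed
  ultimately show ?thesis unfolding big_O_p_def X_def by blast
qed

end
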